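(* Let $\Sigma$ be a compact surface with an Oxtoby-Ulam probability measure $\mu$, and let $F\colon\Sigma\to\Sigma$ be a measurable pseudo-Anosov map. Then $F$ exhibits sensitive dependence on initial conditions: for any metric $d$ on $\Sigma$ compatible with its topology, there is some $\delta>0$ such that for every $x\in\Sigma$ and every neighborhood $N$ of $x$ there are $y\in N$ and $n\ge 0$ with $d(F^n(x),F^n(y))>\delta$.
   Context: Setting. $\Sigma$ is a compact surface and $\mu$ is an Oxtoby-Ulam (OU) measure on $\Sigma$: a Borel measure which is non-atomic, positive on non-empty open sets, and satisfies $\mu(\partial\Sigma)=0$; moreover $\mu(\Sigma)=1$. Measured turbulations. An immersed line is a continuous injective image of $\mathbb{R}$ in $\Sigma$ (with the topology of $\mathbb{R}$). A measured turbulation $(\mathcal{T},\nu)$ on $\Sigma$ is a partition of a full $\mu$-measure Borel subset of $\Sigma$ into immersed lines called streamlines, together with, on each streamline $\ell$, an OU measure $\nu_\ell$ (the stream measure: Borel, non-atomic, positive on non-empty open subsets of $\ell$) which is finite on closed arcs of $\ell$. It has dense streamlines if every streamline is dense in $\Sigma$. For distinct points $x,y$ of a streamline $\ell$, $[x,y]$ denotes the closed arc of $\ell$ with endpoints $x,y$; closed, half-open and open such arcs are called stream arcs, and the measure of a stream arc is its stream measure. $(\mathcal{T},\nu)$ is tame if, for a metric $d$ compatible with the topology of $\Sigma$ (the choice is irrelevant), for every $\epsilon>0$ there is $\delta>0$ such that every stream arc $[x,y]$ with $\nu([x,y])<\delta$ has $d(x,y)<\epsilon$. Two measured turbulations are transverse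 if there is a full $\mu$-measure subset of $\Sigma$ every point $x$ of which lies in streamlines $\ell,\ell'$ of the two turbulations which intersect (topologically) transversely at $x$. Tartans. Let $(\mathcal{T}^s,\nu^s)$, $(\mathcal{T}^u,\nu^u)$ be a transverse pair of measured turbulations, called stable and unstable. A tartan $R=(R^s,R^u)$ consists of Borel subsets $R^s,R^u$ of $\Sigma$ which are disjoint unions of stable and unstable stream arcs respectively (called the stable and unstable fibers of $R$), such that: (a) every arc of $R^s$ intersects every arc of $R^u$ exactly once, either transversely or at an endpoint of one or both arcs; (b) the arcs can be oriented so that every arc of $R^s$ (respectively $R^u$) crosses the arcs of $R^u$ (respectively $R^s$) in the same order; (c) the measures of the arcs of $R^s$ and $R^u$ are bounded above; (d) some open topological disk in $\Sigma$ contains $R^s\cup R^u$. Write $R^\pitchfork=R^s\cap R^u$; $R$ is a positive measure tartan if $\mu(R^\pitchfork)>0$. For $x\in R^\pitchfork$, $\mathfrak{s}(x)$ and $\mathfrak{u}(x)$ are the stable and unstable fibers of $R$ containing $x$; for a stable fiber $\mathfrak{s}$ and unstable fiber $\mathfrak{u}$, $\mathfrak{s}\pitchfork\mathfrak{u}=\mathfrak{u}\pitchfork\mathfrak{s}$ is their unique intersection point, $E^{\mathfrak{s}}=\mathfrak{s}\cap R^\pitchfork$, $E^{\mathfrak{u}}=\mathfrak{u}\cap R^\pitchfork$, and $\nu_{\mathfrak{s}},\nu_{\mathfrak{u}}$ are the restrictions of the stream measures to $E^{\mathfrak{s}},E^{\mathfrak{u}}$. $R$ is compatible if, for all stable and unstable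 fibers $\mathfrak{s},\mathfrak{u}$ of $R$, the bijection $\psi^{\mathfrak{s},\mathfrak{u}}\colon E^{\mathfrak{s}}\times E^{\mathfrak{u}}\to R^\pitchfork$, $(x,y)\mapsto\mathfrak{u}(x)\pitchfork\mathfrak{s}(y)$, is bi-measurable and $\psi^{\mathfrak{s},\mathfrak{u}}_*(\nu_{\mathfrak{s}}\times\nu_{\mathfrak{u}})=\mu|_{R^\pitchfork}$. Fullness. The transverse pair is full if (a) there is a countable collection $R_i$ of positive measure compatible tartans with $\mu(\bigcup_i R_i^\pitchfork)=1$; and (b) for every non-empty open $U\subset\Sigma$ there is a positive measure compatible tartan $R$ with $R^s\cup R^u\subset U$. Measurable pseudo-Anosov maps. A pair $(\mathcal{T}^s,\nu^s),(\mathcal{T}^u,\nu^u)$ are measurable pseudo-Anosov turbulations if they are transverse, tame, full, and have dense streamlines. For a $\mu$-preserving homeomorphism $F\colon\Sigma\to\Sigma$, $F(\mathcal{T},\nu)$ is the measured turbulation with streamlines $F(\ell)$, $\ell\in\mathcal{T}$, and measure $F_*(\nu_\ell)$ on $F(\ell)$. $F$ is measurable pseudo-Anosov if there are measurable pseudo-Anosov turbulations $(\mathcal{T}^s,\nu^s),(\mathcal{T}^u,\nu^u)$ and a number $\lambda>1$ (the dilatation) such that $F(\mathcal{T}^s,\nu^s)=(\mathcal{T}^s,\lambda\nu^s)$ and $F(\mathcal{T}^u,\nu^u)=(\mathcal{T}^u,\lambda^{-1}\nu^u)$. (So $F$ contracts stable stream measure and expands unstable stream measure by the factor $\lambda$.)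 *)

theory Defs
  imports "HOL-Probability.Probability"
begin

section \<open>Surfaces and Oxtoby-Ulam measures\<close>

text \<open>
  The surface is the universe of a Hausdorff, second countable type. Connectedness is not
  demanded separately: it follows from the existence of a dense streamline.
\<close>

definition compact_surface :: "'a::{t2_space, second_countable_topology} itself \<Rightarrow> bool" where
  "compact_surface _ \<longleftrightarrow>
     compact (UNIV :: 'a set) \<and>
     (\<forall>x::'a. \<exists>U V. open U \<and> x \<in> U \<and> openin (top_of_set {z::complex. 0 \<le> Im z}) V \<and>
        U homeomorphic V)"

definition surface_boundary :: "'a::topological_space set" where
  "surface_boundary = {x. \<not> (\<exists>U. open U \<and> x \<in> U \<and> U homeomorphic ball (0::complex) 1)}"

definition compatible_metric :: "('a::topological_space \<Rightarrow> 'a \<Rightarrow> real) \<Rightarrow> bool" where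
  "compatible_metric d \<longleftrightarrow>
     Metric_space UNIV d \<and> Metric_space.mtopology UNIV d = euclidean"

definition borel_of :: "'a topology \<Rightarrow> 'a measure" where
  "borel_of X = sigma (topspace X) {U. openin X U}"

definition atom_of :: "'a measure \<Rightarrow> 'a set \<Rightarrow> bool" where
  "atom_of M A \<longleftrightarrow> A \<in> sets M \<and> 0 < emeasure M A \<and>
     (\<forall>B\<in>sets M. B \<subseteq> A \<longrightarrow> emeasure M B = 0 \<or> emeasure M (A - B) = 0)"

text \<open>
  The second argument is the boundary of the manifold \<open>X\<close>; it is empty for streamlines.
\<close>

definition oxtoby_ulam :: "'a topology \<Rightarrow> 'a set \<Rightarrow> 'a measure \<Rightarrow> bool" where
  "oxtoby_ulam X bd M \<longleftrightarrow>
     space M = topspace X \<and> sets M = sets (borel_of X) \<and>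
     (\<nexists>A. atom_of M A) \<and>
     (\<forall>U. openin X U \<and> U \<noteq> {} \<longrightarrow> 0 < emeasure M U) \<and>
     bd \<in> sets M \<and> emeasure M bd = 0"


section \<open>Measured turbulations\<close>

text \<open>
  An immersed line is recorded by the topology it inherits from the real line. This is finer
  than the subspace topology of the surface, and it is not determined by the underlying set:
  a figure eight, for instance, is an injective continuous image of the line in two ways.
\<close>

definition immersed_line :: "'a::topological_space topology \<Rightarrow> bool" where
  "immersed_line L \<longleftrightarrow> L homeomorphic_space euclideanreal \<and> continuous_map L euclidean id"

definition closed_arc :: "'a topology \<Rightarrow> 'a \<Rightarrow> 'a \<Rightarrow> 'a set \<Rightarrow> bool" where
  "closed_arc L x y A \<longleftrightarrow>
     (\<exists>f a b. homeomorphic_map euclideanreal L f \<and> a < b \<and> f a = x \<and> f b = y \<and> A = f ` {a..b})"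

definition stream_arc :: "'a topology \<Rightarrow> 'a \<Rightarrow> 'a \<Rightarrow> 'a set \<Rightarrow> bool" where
  "stream_arc L x y A \<longleftrightarrow>
     (\<exists>f a b. homeomorphic_map euclideanreal L f \<and> a < b \<and> f a = x \<and> f b = y \<and>
        A \<in> {f ` {a..b}, f ` {a..<b}, f ` {a<..b}, f ` {a<..<b}})"

definition stream_measure :: "'a topology \<Rightarrow> 'a measure \<Rightarrow> bool" where
  "stream_measure L m \<longleftrightarrow>
     oxtoby_ulam L {} m \<and> (\<forall>x y A. closed_arc L x y A \<longrightarrow> emeasure m A < \<infinity>)"

text \<open>A turbulation is the set of its streamlines, each paired with its stream measure.\<close>

type_synonym 'a turbulation = "('a topology \<times> 'a measure) set"

definition measured_turbulation :: "'a::topological_space measure \<Rightarrow> 'a turbulation \<Rightarrow> bool" where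
  "measured_turbulation \<mu> T \<longleftrightarrow>
     (\<forall>(L, m)\<in>T. immersed_line L \<and> stream_measure L m) \<and>
     disjoint_family_on (\<lambda>(L, m). topspace L) T \<and>
     (\<Union>(L, m)\<in>T. topspace L) \<in> sets borel \<and>
     emeasure \<mu> (UNIV - (\<Union>(L, m)\<in>T. topspace L)) = 0"

definition dense_streamlines :: "'a::topological_space turbulation \<Rightarrow> bool" where
  "dense_streamlines T \<longleftrightarrow> (\<forall>(L, m)\<in>T. closure (topspace L) = UNIV)"

definition tame :: "'a::topological_space turbulation \<Rightarrow> bool" where
  "tame T \<longleftrightarrow>
     (\<exists>d. compatible_metric d \<and>
        (\<forall>\<epsilon>>0. \<exists>\<delta>>0. \<forall>(L, m)\<in>T. \<forall>x y A.
           closed_arc L x y A \<and> emeasure m A < ennreal \<delta> \<longrightarrow> d x y < \<epsilon>))"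

text \<open>
  Topological transversality: some chart takes the local pieces of the two lines through \<open>x\<close>
  to the coordinate axes. The local pieces are components in the line topologies, because a
  streamline may return to \<open>U\<close> infinitely often.
\<close>

definition transverse_at ::
    "'a::topological_space topology \<Rightarrow> 'a topology \<Rightarrow> 'a \<Rightarrow> bool" where
  "transverse_at L L' x \<longleftrightarrow> x \<in> topspace L \<and> x \<in> topspace L' \<and>
     (\<exists>U h g. open U \<and> x \<in> U \<and> homeomorphism U (UNIV :: complex set) h g \<and> h x = 0 \<and>
        h ` connected_component_of_set (subtopology L U) x = {z. Im z = 0} \<and>
        h ` connected_component_of_set (subtopology L' U) x = {z. Re z = 0})"

definition transverse_pair ::
    "'a::topological_space measure \<Rightarrow> 'a turbulation \<Rightarrow> 'a turbulation \<Rightarrow> bool" where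
  "transverse_pair \<mu> Ts Tu \<longleftrightarrow>
     measured_turbulation \<mu> Ts \<and> measured_turbulation \<mu> Tu \<and>
     (AE x in \<mu>. \<exists>(L, m)\<in>Ts. \<exists>(L', m')\<in>Tu. transverse_at L L' x)"


section \<open>Tartans\<close>

text \<open>A tartan is given by its set of stable fibers and its set of unstable fibers.\<close>

type_synonym 'a tartan = "'a set set \<times> 'a set set"

definition fiber_family :: "'a::topological_space turbulation \<Rightarrow> 'a set set \<Rightarrow> bool" where
  "fiber_family T R \<longleftrightarrow>
     (\<forall>A\<in>R. \<exists>(L, m)\<in>T. \<exists>x y. stream_arc L x y A) \<and> disjoint R \<and> \<Union>R \<in> sets borel"

definition fiber_endpoint :: "'a turbulation \<Rightarrow> 'a set \<Rightarrow> 'a \<Rightarrow> bool" where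
  "fiber_endpoint T A p \<longleftrightarrow> (\<exists>(L, m)\<in>T. \<exists>x y. stream_arc L x y A \<and> p \<in> {x, y})"

text \<open>
  An orientation of a family of fibers chooses, for each fiber, a parametrization of the
  streamline carrying it; only the direction of the parametrization matters.
\<close>

definition orientation :: "'a turbulation \<Rightarrow> 'a set set \<Rightarrow> ('a set \<Rightarrow> real \<Rightarrow> 'a) \<Rightarrow> bool" where
  "orientation T R \<phi> \<longleftrightarrow>
     (\<forall>A\<in>R. \<exists>(L, m)\<in>T. A \<subseteq> topspace L \<and> homeomorphic_map euclideanreal L (\<phi> A))"

definition before :: "(real \<Rightarrow> 'a) \<Rightarrow> 'a \<Rightarrow> 'a \<Rightarrow> bool" where
  "before f x y \<longleftrightarrow> (\<exists>a b. a < b \<and> f a = x \<and> f b = y)"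

definition cross :: "'a set \<Rightarrow> 'a set \<Rightarrow> 'a" where
  "cross s u = the_elem (s \<inter> u)"

text \<open>Every fiber in \<open>R\<close> crosses the fibers in \<open>R'\<close> in the same order.\<close>

definition same_crossing_order ::
    "('a set \<Rightarrow> real \<Rightarrow> 'a) \<Rightarrow> 'a set set \<Rightarrow> 'a set set \<Rightarrow> bool" where
  "same_crossing_order \<phi> R R' \<longleftrightarrow>
     (\<forall>s\<in>R. \<forall>s'\<in>R. \<forall>u\<in>R'. \<forall>u'\<in>R'.
        before (\<phi> s) (cross s u) (cross s u') \<longleftrightarrow> before (\<phi> s') (cross s' u) (cross s' u'))"

definition bounded_fibers :: "'a turbulation \<Rightarrow> 'a set set \<Rightarrow> bool" where
  "bounded_fibers T R \<longleftrightarrow>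
     (\<exists>B::real. \<forall>A\<in>R. \<forall>(L, m)\<in>T. A \<subseteq> topspace L \<longrightarrow> emeasure m A \<le> ennreal B)"

definition is_tartan ::
    "'a::topological_space turbulation \<Rightarrow> 'a turbulation \<Rightarrow> 'a tartan \<Rightarrow> bool" where
  "is_tartan Ts Tu = (\<lambda>(RS, RU).
     fiber_family Ts RS \<and> fiber_family Tu RU \<and>
     (\<forall>s\<in>RS. \<forall>u\<in>RU. \<exists>p. s \<inter> u = {p} \<and>
        (fiber_endpoint Ts s p \<or> fiber_endpoint Tu u p \<or>
         (\<exists>(L, m)\<in>Ts. \<exists>(L', m')\<in>Tu. transverse_at L L' p))) \<and>
     (\<exists>\<phi> \<psi>. orientation Ts RS \<phi> \<and> orientation Tu RU \<psi> \<and>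
        same_crossing_order \<phi> RS RU \<and> same_crossing_order \<psi> RU RS) \<and>
     bounded_fibers Ts RS \<and> bounded_fibers Tu RU \<and>
     (\<exists>D. open D \<and> D homeomorphic ball (0::complex) 1 \<and> \<Union>RS \<union> \<Union>RU \<subseteq> D))"

definition tartan_crossings :: "'a tartan \<Rightarrow> 'a set" where
  "tartan_crossings = (\<lambda>(RS, RU). \<Union>RS \<inter> \<Union>RU)"

definition positive_tartan :: "'a measure \<Rightarrow> 'a tartan \<Rightarrow> bool" where
  "positive_tartan \<mu> R \<longleftrightarrow> 0 < emeasure \<mu> (tartan_crossings R)"

definition fiber_through :: "'a set set \<Rightarrow> 'a \<Rightarrow> 'a set" where
  "fiber_through R x = (THE A. A \<in> R \<and> x \<in> A)"

definition tartan_product_map :: "'a tartan \<Rightarrow> 'a \<times> 'a \<Rightarrow> 'a" where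
  "tartan_product_map = (\<lambda>(RS, RU) (x, y). cross (fiber_through RU x) (fiber_through RS y))"

definition compatible_tartan ::
    "'a::topological_space measure \<Rightarrow> 'a turbulation \<Rightarrow> 'a turbulation \<Rightarrow> 'a tartan \<Rightarrow> bool" where
  "compatible_tartan \<mu> Ts Tu R \<longleftrightarrow>
     (\<forall>s\<in>fst R. \<forall>u\<in>snd R. \<forall>(L, m)\<in>Ts. \<forall>(L', m')\<in>Tu.
        s \<subseteq> topspace L \<longrightarrow> u \<subseteq> topspace L' \<longrightarrow>
        (let C = tartan_crossings R;
             Es = s \<inter> C; Eu = u \<inter> C;
             P = restrict_space m Es \<Otimes>\<^sub>M restrict_space m' Eu;
             Q = restrict_space \<mu> C;
             f = tartan_product_map R
         in f \<in> measurable P Q \<and> the_inv_into (Es \<times> Eu) f \<in> measurable Q P \<and>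
            distr P Q f = Q))"

definition full_pair ::
    "'a::topological_space measure \<Rightarrow> 'a turbulation \<Rightarrow> 'a turbulation \<Rightarrow> bool" where
  "full_pair \<mu> Ts Tu \<longleftrightarrow>
     (let good = (\<lambda>R. is_tartan Ts Tu R \<and> positive_tartan \<mu> R \<and> compatible_tartan \<mu> Ts Tu R)
      in (\<exists>\<R>. countable \<R> \<and> (\<forall>R\<in>\<R>. good R) \<and> emeasure \<mu> (\<Union>R\<in>\<R>. tartan_crossings R) = 1) \<and>
         (\<forall>U. open U \<and> U \<noteq> {} \<longrightarrow> (\<exists>R. good R \<and> \<Union>(fst R) \<union> \<Union>(snd R) \<subseteq> U)))"


section \<open>Measurable pseudo-Anosov maps\<close>

definition pseudo_Anosov_turbulations ::
    "'a::topological_space measure \<Rightarrow> 'a turbulation \<Rightarrow> 'a turbulation \<Rightarrow> bool" where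
  "pseudo_Anosov_turbulations \<mu> Ts Tu \<longleftrightarrow>
     transverse_pair \<mu> Ts Tu \<and> tame Ts \<and> tame Tu \<and> full_pair \<mu> Ts Tu \<and>
     dense_streamlines Ts \<and> dense_streamlines Tu"

text \<open>The line \<open>F(L)\<close> carries the topology transported by \<open>F\<close>, which is meant to be injective.\<close>

definition image_topology :: "('a \<Rightarrow> 'a) \<Rightarrow> 'a topology \<Rightarrow> 'a topology" where
  "image_topology F L = pullback_topology (F ` topspace L) (the_inv_into (topspace L) F) L"

definition image_turbulation :: "('a \<Rightarrow> 'a) \<Rightarrow> 'a turbulation \<Rightarrow> 'a turbulation" where
  "image_turbulation F T =
     (\<lambda>(L, m). (image_topology F L, distr m (borel_of (image_topology F L)) F)) ` T"

definition scale_turbulation :: "real \<Rightarrow> 'a turbulation \<Rightarrow> 'a turbulation" where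
  "scale_turbulation c T = (\<lambda>(L, m). (L, scale_measure (ennreal c) m)) ` T"

definition measurable_pseudo_Anosov ::
    "'a::topological_space measure \<Rightarrow> ('a \<Rightarrow> 'a) \<Rightarrow> bool" where
  "measurable_pseudo_Anosov \<mu> F \<longleftrightarrow>
     (\<exists>G. homeomorphism UNIV UNIV F G) \<and> distr \<mu> \<mu> F = \<mu> \<and>
     (\<exists>Ts Tu lam. pseudo_Anosov_turbulations \<mu> Ts Tu \<and> lam > 1 \<and>
        image_turbulation F Ts = scale_turbulation lam Ts \<and>
        image_turbulation F Tu = scale_turbulation (inverse lam) Tu)"

end

theory Submission
  imports Defs
begin

text \<open>
  Sensitivity comes from the expansion of unstable arcs, and the point is to see that a long
  unstable arc cannot stay small. An arbitrary long arc could perhaps be contained in a small ball: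
  density is assumed only for whole streamlines, not for half of one, and nothing bounds how
  much measure is needed to leave a ball. Recurrence in measure supplies what is missing.

  Suppose that all forward images of some non-empty open set \<open>U\<close> lie in balls of radius \<open>\<delta>\<close>. Take
  a compatible tartan of positive measure inside \<open>U\<close>. It has a set \<open>M\<close> of crossings, of positive
  \<open>\<mu>\<close>-measure, and an \<open>\<eta> > 0\<close> such that the unstable fiber through each point of \<open>M\<close> has measure at
  least \<open>\<eta>\<close> on both sides of the point (\<open>middle_crossings\<close>). This is where compatibility and the
  order of crossings enter: compatibility makes holonomy along stable fibers measure
  preserving (\<open>slide_measure\<close>), so the middle third of a single unstable fiber can be
  carried to all others.

  The sets \<open>F\<^sup>n(M)\<close> all have the same positive measure, so some point \<open>z\<close> lies in infinitely many
  of them (\<open>frequently_in_sets_of_large_measure\<close>). For each such \<open>n\<close> the image under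
  \<open>F\<^sup>n\<close> of a fiber is an arc around \<open>z\<close> of the unstable streamline through \<open>z\<close>. It contains measure
  at least \<open>\<lambda>\<^sup>n \<eta>\<close> on both sides of \<open>z\<close> (\<open>scaled_image_iterate\<close>), and it lies in \<open>F\<^sup>n(U)\<close>, hence within
  distance \<open>2 \<delta>\<close> of \<open>z\<close>. Closed arcs have finite measure, so these arcs exhaust the streamline
  (\<open>long_arc_reaches\<close>), and the whole streamline lies within \<open>2 \<delta>\<close> of \<open>z\<close>. It is dense, so the
  diameter of the surface is at most \<open>4 \<delta>\<close>, which fails for small \<open>\<delta>\<close>.
\<close>


section \<open>Borel sets of a topology\<close>

lemma space_borel_of: "space (borel_of X) = topspace X"
  unfolding borel_of_def by (rule space_measure_of) (auto dest: openin_subset)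

lemma sets_borel_of: "sets (borel_of X) = sigma_sets (topspace X) {U. openin X U}"
  unfolding borel_of_def by (rule sets_measure_of) (auto dest: openin_subset)

lemma borel_of_euclidean: "borel_of euclidean = borel"
  by (simp add: borel_of_def borel_def)

lemma measurable_borel_of:
  assumes "continuous_map X Y f"
  shows "f \<in> measurable (borel_of X) (borel_of Y)"
  unfolding borel_of_def[of Y]
proof (rule measurable_sigma_sets[OF sets_borel_of[of Y, unfolded borel_of_def]])
  show "{U. openin Y U} \<subseteq> Pow (topspace Y)"
    by (auto dest: openin_subset)
  show "f \<in> space (borel_of X) \<rightarrow> topspace Y"
    using assms by (auto simp: space_borel_of continuous_map_def)
  fix U assume "U \<in> {U. openin Y U}"
  then have "openin X {x \<in> topspace X. f x \<in> U}"
    using assms by (simp add: openin_continuous_map_preimage)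
  moreover have "{x \<in> topspace X. f x \<in> U} = f -` U \<inter> space (borel_of X)"
    by (auto simp: space_borel_of)
  ultimately show "f -` U \<inter> space (borel_of X) \<in> sets (borel_of X)"
    by (auto simp: sets_borel_of)
qed

lemma homeomorphic_map_image_borel_of:
  assumes "homeomorphic_map X Y g" "S \<in> sets (borel_of X)"
  shows "g ` S \<in> sets (borel_of Y)"
proof -
  obtain h where h: "homeomorphic_maps X Y g h"
    using assms(1) homeomorphic_map_maps by blast
  have "S \<subseteq> topspace X"
    using sets.sets_into_space[OF assms(2)] by (simp add: space_borel_of)
  then have "g ` S = h -` S \<inter> space (borel_of Y)"
    unfolding space_borel_of
  proof (intro equalityI subsetI)
    show "y \<in> h -` S \<inter> topspace Y" if "y \<in> g ` S" for y
      using that \<open>S \<subseteq> topspace X\<close> h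
      by (auto simp: homeomorphic_maps_def continuous_map_def)
    show "y \<in> g ` S" if "y \<in> h -` S \<inter> topspace Y" for y
      using that h by (intro image_eqI[of _ _ "h y"]) (auto simp: homeomorphic_maps_def)
  qed
  moreover have "h \<in> measurable (borel_of Y) (borel_of X)"
    using h by (auto simp: homeomorphic_maps_def intro: measurable_borel_of)
  ultimately show ?thesis
    using assms(2) by (metis measurable_sets)
qed

text \<open>
  A point of positive measure would be an atom.
\<close>
lemma oxtoby_ulam_singleton_null:
  assumes "oxtoby_ulam X bd M"
  shows "emeasure M {x} = 0"
proof (rule ccontr)
  assume pos: "emeasure M {x} \<noteq> 0"
  have "atom_of M {x}"
    unfolding atom_of_def
  proof (intro conjI ballI impI)
    show "{x} \<in> sets M"
      using pos emeasure_notin_sets by blast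
    show "0 < emeasure M {x}"
      using pos by (simp add: zero_less_iff_neq_zero)
    fix B assume "B \<subseteq> {x}"
    then have "B = {} \<or> B = {x}" by auto
    then show "emeasure M B = 0 \<or> emeasure M ({x} - B) = 0" by auto
  qed
  then show False
    using assms by (auto simp: oxtoby_ulam_def)
qed


section \<open>Streamlines and their arcs\<close>

lemma stream_measure_space_sets:
  assumes "stream_measure L m"
  shows "space m = topspace L" "sets m = sets (borel_of L)"
  using assms by (auto simp: stream_measure_def oxtoby_ulam_def)

lemma connectedin_line_preimage:
  assumes "homeomorphic_map euclideanreal L g" "connectedin L A"
  shows "is_interval (g -` A)"
proof -
  obtain h where h: "homeomorphic_maps euclideanreal L g h"
    using assms(1) homeomorphic_map_maps by blast
  have "A \<subseteq> topspace L"
    using assms(2) connectedin_subset_topspace by blast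
  have gh: "h (g x) = x" "y \<in> topspace L \<Longrightarrow> g (h y) = y" for x y
    using h by (simp_all add: homeomorphic_maps_def)
  have "g -` A = h ` A"
  proof (intro equalityI subsetI)
    show "x \<in> h ` A" if "x \<in> g -` A" for x
      using that gh(1)[of x] by (metis imageI vimageE)
    show "x \<in> g -` A" if "x \<in> h ` A" for x
      using that \<open>A \<subseteq> topspace L\<close> gh(2) by auto
  qed
  moreover have "connectedin euclideanreal (h ` A)"
    using connectedin_continuous_map_image[of L euclideanreal h A] h assms(2)
    by (simp add: homeomorphic_maps_def)
  ultimately show ?thesis
    by (simp add: is_interval_connected_1)
qed

lemma connectedin_line_borel:
  assumes "homeomorphic_map euclideanreal L g" "connectedin L A"
  shows "A \<in> sets (borel_of L)"
proof -
  have "A \<subseteq> range g"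
    using assms connectedin_subset_topspace homeomorphic_imp_surjective_map by fastforce
  then have "A = g ` (g -` A)" by auto
  moreover have "g -` A \<in> sets (borel_of euclidean)"
    using connectedin_line_preimage[OF assms]
    by (simp add: borel_of_euclidean real_interval_borel_measurable)
  ultimately show ?thesis
    using homeomorphic_map_image_borel_of[OF assms(1), of "g -` A"] by simp
qed

lemma stream_arc_line:
  assumes "stream_arc L x y A"
  shows "connectedin L A" "A \<noteq> {}"
proof -
  obtain f a b where f: "homeomorphic_map euclideanreal L f" "a < b"
    "A \<in> {f ` {a..b}, f ` {a..<b}, f ` {a<..b}, f ` {a<..<b}}"
    using assms unfolding stream_arc_def by metis
  define p where "p = (a + b) / 2"
  have p: "a < p" "p < b" using f(2) by (auto simp: p_def)
  have "\<exists>I\<in>{{a..b}, {a..<b}, {a<..b}, {a<..<b}}. A = f ` I"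
    using f(3) by blast
  then obtain I where I: "A = f ` I" "I \<in> {{a..b}, {a..<b}, {a<..b}, {a<..<b}}"
    by blast
  have "connected I" "p \<in> I"
    using I(2) p by auto
  then show "connectedin L A" "A \<noteq> {}"
    using connectedin_continuous_map_image[OF homeomorphic_imp_continuous_map[OF f(1)], of I]
    by (auto simp: I(1))
qed

lemma streamline_unique:
  assumes "measured_turbulation \<mu> T" "(L, m) \<in> T" "(L', m') \<in> T"
    and "x \<in> topspace L" "x \<in> topspace L'"
  shows "L = L'" "m = m'"
proof -
  have "disjoint_family_on (\<lambda>(L, m). topspace L) T"
    using assms(1) by (simp add: measured_turbulation_def)
  then have "(L, m) = (L', m')"
    using disjoint_family_onD[of _ T "(L, m)" "(L', m')"] assms(2-5) by blast
  then show "L = L'" "m = m'" by auto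
qed

lemma fiber_carrier:
  assumes "fiber_family T R" "A \<in> R"
  obtains L m where "(L, m) \<in> T" "A \<subseteq> topspace L"
proof -
  obtain L m x y where A: "(L, m) \<in> T" "stream_arc L x y A"
    using assms unfolding fiber_family_def by blast
  then show ?thesis
    using that stream_arc_line(1)[OF A(2)] connectedin_subset_topspace by metis
qed

lemma fiber_connected:
  assumes "measured_turbulation \<mu> T" "fiber_family T R" "A \<in> R"
    and "(L, m) \<in> T" "A \<subseteq> topspace L"
  shows "connectedin L A"
proof -
  obtain L' m' x y where A: "(L', m') \<in> T" "stream_arc L' x y A"
    using assms unfolding fiber_family_def by blast
  obtain z where "z \<in> A"
    using stream_arc_line(2)[OF A(2)] by blast
  then have "z \<in> topspace L" "z \<in> topspace L'"
    using assms(5) stream_arc_line(1)[OF A(2)] connectedin_subset_topspace by auto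
  then have "L' = L"
    using streamline_unique(1)[OF assms(1) A(1) assms(4)] by simp
  then show ?thesis
    using stream_arc_line(1)[OF A(2)] by simp
qed

text \<open>
  Stream measures have no point masses, so the distribution function of the measure on \<open>E\<close>
  along the line is continuous and takes the values one third and two thirds of the total.
\<close>
lemma stream_measure_thirds:
  assumes g: "homeomorphic_map euclideanreal L g" and m: "stream_measure L m"
    and E: "E \<in> sets m" "0 < emeasure m E" "emeasure m E < \<infinity>"
  obtains t t' where "0 < emeasure m (E \<inter> g ` {..t})" "0 < emeasure m (E \<inter> g ` {t<..t'})"
    "0 < emeasure m (E \<inter> g ` {t'<..})"
proof -
  note sm = stream_measure_space_sets[OF m]
  obtain h where h: "homeomorphic_maps euclideanreal L g h"
    using g homeomorphic_map_maps by blast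
  have gh: "h (g x) = x" "y \<in> topspace L \<Longrightarrow> g (h y) = y" for x y
    using h by (simp_all add: homeomorphic_maps_def)
  have h_meas: "h \<in> measurable m borel"
    using measurable_borel_of[of L euclideanreal h] h
    by (simp add: homeomorphic_maps_def borel_of_euclidean cong: measurable_cong_sets[OF sm(2) refl])
  have EL: "E \<subseteq> topspace L"
    using sets.sets_into_space[OF E(1)] sm(1) by simp
  define K where "K = distr (restrict_space m E) borel h"
  have h_meas': "h \<in> measurable (restrict_space m E) borel"
    by (rule measurable_restrict_space1[OF h_meas])
  have K: "emeasure K S = emeasure m (E \<inter> g ` S)" if "S \<in> sets borel" for S
  proof -
    have "h -` S \<inter> E = E \<inter> g ` S"
    proof (intro equalityI subsetI)
      show "y \<in> E \<inter> g ` S" if "y \<in> h -` S \<inter> E" for y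
        using that EL gh(2)[of y] by (metis IntE IntI imageI subsetD vimageE)
      show "y \<in> h -` S \<inter> E" if "y \<in> E \<inter> g ` S" for y
        using that gh(1) by auto
    qed
    then show ?thesis
      unfolding K_def using that EL sm(1) E(1)
      by (subst emeasure_distr[OF h_meas'])
         (auto simp: space_restrict_space emeasure_restrict_space Int_absorb2)
  qed
  have gE: "E \<inter> range g = E"
    using EL homeomorphic_imp_surjective_map[OF g] by auto
  have "emeasure K (space K) \<noteq> top"
    using K[of UNIV] E(3) gE by (simp add: K_def)
  then interpret K: finite_borel_measure K
    by (intro finite_borel_measure.intro finite_measureI finite_borel_measure_axioms.intro)
       (auto simp: K_def)
  define c where "c = measure K UNIV"
  have "ennreal c > 0"
    using K[of UNIV] E(2) gE by (simp add: c_def K.emeasure_eq_measure)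
  then have "c > 0"
    by simp
  have "isCont (cdf K) x" for x
  proof -
    have "emeasure m (E \<inter> g ` {x}) \<le> emeasure m {g x}"
      using homeomorphic_map_image_borel_of[OF g, of "{x}"] sm(2)
      by (intro emeasure_mono) (auto simp: borel_of_euclidean)
    also have "\<dots> = 0"
      using m oxtoby_ulam_singleton_null by (auto simp: stream_measure_def)
    finally have "emeasure K {x} = 0"
      using K[of "{x}"] by simp
    then show ?thesis
      unfolding K.isCont_cdf by (simp add: measure_def)
  qed
  then have cont: "continuous_on UNIV (cdf K)"
    by (simp add: continuous_at_imp_continuous_on)
  have attained: "\<exists>x. cdf K x = r" if "0 < r" "r < c" for r
  proof -
    have "eventually (\<lambda>x. cdf K x < r) at_bot"
      using order_tendstoD(2)[OF K.cdf_lim_at_bot that(1)] .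
    then obtain a where a: "cdf K a < r"
      by (metis eventually_at_bot_linorder order_refl)
    have "eventually (\<lambda>x. r < cdf K x) at_top"
      using order_tendstoD(1)[OF K.cdf_lim_at_top, of r] that(2) by (simp add: c_def K.borel_UNIV)
    then obtain b where b: "r < cdf K b"
      by (metis eventually_at_top_linorder order_refl)
    have "a \<le> b"
      using a b K.cdf_nondecreasing[of b a] by linarith
    then show ?thesis
      using IVT'[of "cdf K" a r b] a b continuous_on_subset[OF cont] by fastforce
  qed
  obtain t where t: "cdf K t = c / 3"
    using attained[of "c / 3"] \<open>c > 0\<close> by auto
  obtain t' where t': "cdf K t' = 2 * c / 3"
    using attained[of "2 * c / 3"] \<open>c > 0\<close> by auto
  have "t < t'"
    using t t' \<open>c > 0\<close> K.cdf_nondecreasing[of t' t] by (cases "t < t'") auto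
  have "measure K {..t} > 0" "measure K {t<..t'} > 0"
    using t t' K.cdf_diff_eq[OF \<open>t < t'\<close>] \<open>c > 0\<close> by (auto simp: cdf_def)
  moreover have "measure K {t'<..} > 0"
  proof -
    have "{t'<..} = UNIV - {..t'}" by auto
    then have "measure K {t'<..} = c - 2 * c / 3"
      using t' K.finite_measure_compl[of "{..t'}"] K.M_is_borel by (simp add: c_def cdf_def K.borel_UNIV)
    then show ?thesis using \<open>c > 0\<close> by simp
  qed
  ultimately have "emeasure K {..t} > 0" "emeasure K {t<..t'} > 0" "emeasure K {t'<..} > 0"
    by (simp_all add: K.emeasure_eq_measure)
  then show ?thesis
    using that[of t t'] K by simp
qed

section \<open>Holonomy in compatible tartans\<close>

text \<open>
  Sliding a crossing along its stable fiber to a fixed unstable fiber; in the product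
  coordinates of the tartan this is the projection to the second factor.
\<close>
definition slide :: "'a set set \<Rightarrow> 'a set \<Rightarrow> 'a \<Rightarrow> 'a" where
  "slide RS u p = cross u (fiber_through RS p)"

lemma fiber_through_eq:
  assumes "disjoint R" "A \<in> R" "x \<in> A"
  shows "fiber_through R x = A"
  unfolding fiber_through_def
  using assms by (intro the_equality) (auto simp: disjoint_def)

lemma is_tartanD:
  assumes "is_tartan Ts Tu (RS, RU)"
  shows "fiber_family Ts RS" "fiber_family Tu RU" "disjoint RS" "disjoint RU"
    and "s \<in> RS \<Longrightarrow> u \<in> RU \<Longrightarrow> s \<inter> u = {cross u s}"
    and "tartan_crossings (RS, RU) \<in> sets borel"
    and "bounded_fibers Ts RS" "bounded_fibers Tu RU"
    and "\<exists>\<psi>. orientation Tu RU \<psi> \<and> same_crossing_order \<psi> RU RS"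
proof -
  show ff: "fiber_family Ts RS" "fiber_family Tu RU"
    and "bounded_fibers Ts RS" "bounded_fibers Tu RU"
    and "\<exists>\<psi>. orientation Tu RU \<psi> \<and> same_crossing_order \<psi> RU RS"
    using assms unfolding is_tartan_def by blast+
  show "disjoint RS" "disjoint RU" "tartan_crossings (RS, RU) \<in> sets borel"
    using ff by (auto simp: fiber_family_def tartan_crossings_def)
  show "s \<inter> u = {cross u s}" if su: "s \<in> RS" "u \<in> RU"
  proof -
    have "\<forall>s\<in>RS. \<forall>u\<in>RU. \<exists>p. s \<inter> u = {p} \<and>
        (fiber_endpoint Ts s p \<or> fiber_endpoint Tu u p \<or>
         (\<exists>(L, m)\<in>Ts. \<exists>(L', m')\<in>Tu. transverse_at L L' p))"
      using assms unfolding is_tartan_def case_prod_conv by (elim conjE)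
    from bspec[OF bspec[OF this su(1)] su(2)] obtain p where "s \<inter> u = {p}"
      by (elim exE conjE)
    then show ?thesis
      by (simp add: cross_def Int_commute)
  qed
qed

lemma fiber_crossings_measurable:
  assumes T: "measured_turbulation \<mu> T" and R: "fiber_family T R" "bounded_fibers T R"
    and A: "A \<in> R" "(L, m) \<in> T" "A \<subseteq> topspace L" and W: "W \<in> sets borel"
  shows "A \<inter> W \<in> sets m" "emeasure m (A \<inter> W) < \<infinity>"
proof -
  have L: "immersed_line L" and m: "stream_measure L m"
    using T A(2) by (auto simp: measured_turbulation_def)
  note sm = stream_measure_space_sets[OF m]
  obtain g where g: "homeomorphic_map euclideanreal L g"
    using L by (metis immersed_line_def homeomorphic_space homeomorphic_space_sym)
  have A_sets: "A \<in> sets m"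
    using connectedin_line_borel[OF g fiber_connected[OF T R(1) A]] sm(2) by simp
  have "id \<in> measurable (borel_of L) borel"
    using L measurable_borel_of[of L euclidean id]
    by (simp add: immersed_line_def borel_of_euclidean)
  then have "topspace L \<inter> W \<in> sets m"
    using measurable_sets[of id "borel_of L" borel W] W sm(2)
    by (simp add: space_borel_of Int_commute)
  then have "A \<inter> (topspace L \<inter> W) \<in> sets m"
    using A_sets by blast
  moreover have "A \<inter> (topspace L \<inter> W) = A \<inter> W"
    using A(3) by auto
  ultimately show "A \<inter> W \<in> sets m" by simp
  obtain B :: real where "emeasure m A \<le> ennreal B"
    using R(2) A unfolding bounded_fibers_def by blast
  moreover have "emeasure m (A \<inter> W) \<le> emeasure m A"
    using A_sets by (intro emeasure_mono) auto
  ultimately show "emeasure m (A \<inter> W) < \<infinity>"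
    by (metis ennreal_less_top infinity_ennreal_def order_le_less_trans)
qed

text \<open>
  Compatibility says that in product coordinates \<open>\<mu>\<close> is the product of the two stream measures.
  Hence the preimage of \<open>Y\<close> under the slide to an unstable fiber is a box \<open>E \<times> Y\<close>, whose first
  side is a stable fiber. The factor \<open>k\<close> is the measure of that side; it is the same for
  all unstable fibers, which makes holonomy between them measure preserving.
\<close>
lemma slide_measure:
  assumes Ts: "measured_turbulation \<mu> Ts" and Tu: "measured_turbulation \<mu> Tu"
    and \<mu>: "sets \<mu> = sets borel"
    and R: "is_tartan Ts Tu (RS, RU)" "positive_tartan \<mu> (RS, RU)"
      "compatible_tartan \<mu> Ts Tu (RS, RU)"
  defines "C \<equiv> tartan_crossings (RS, RU)"
  obtains k where "0 < k" "k < \<infinity>"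
    "\<And>u L m Y. u \<in> RU \<Longrightarrow> (L, m) \<in> Tu \<Longrightarrow> u \<subseteq> topspace L \<Longrightarrow> Y \<in> sets m \<Longrightarrow> Y \<subseteq> u \<inter> C \<Longrightarrow>
       {p \<in> C. slide RS u p \<in> Y} \<in> sets borel \<and>
       emeasure \<mu> {p \<in> C. slide RS u p \<in> Y} = k * emeasure m Y"
proof -
  note RD = is_tartanD[OF R(1)]
  have C: "C = \<Union>RS \<inter> \<Union>RU" "C \<in> sets borel"
    using RD(6) by (auto simp: C_def tartan_crossings_def)
  have sp_mu: "space \<mu> = UNIV"
    using sets_eq_imp_space_eq[OF \<mu>] by simp
  have C_pos: "0 < emeasure \<mu> C"
    using R(2) by (simp add: positive_tartan_def C_def)
  then obtain c where "c \<in> C"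
    by (metis all_not_in_conv emeasure_empty less_irrefl)
  then obtain s u0 where su0: "s \<in> RS" "u0 \<in> RU" "c \<in> s" "c \<in> u0"
    using C(1) by auto
  obtain Ls ms where Ls: "(Ls, ms) \<in> Ts" "s \<subseteq> topspace Ls"
    using fiber_carrier[OF RD(1) su0(1)] .
  obtain L0 m0 where L0: "(L0, m0) \<in> Tu" "u0 \<subseteq> topspace L0"
    using fiber_carrier[OF RD(2) su0(2)] .
  note Es = fiber_crossings_measurable[OF Ts RD(1) RD(7) su0(1) Ls C(2)]
  define k where "k = emeasure ms (s \<inter> C)"
  have through: "fiber_through RS p \<in> RS" "p \<in> fiber_through RS p"
    "fiber_through RU p \<in> RU" "p \<in> fiber_through RU p" if "p \<in> C" for p
    using that C(1) fiber_through_eq[OF RD(3)] fiber_through_eq[OF RD(4)] by auto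
  have main: "{p \<in> C. slide RS u p \<in> Y} \<in> sets borel \<and>
       emeasure \<mu> {p \<in> C. slide RS u p \<in> Y} = k * emeasure m Y"
    if u: "u \<in> RU" "(L, m) \<in> Tu" "u \<subseteq> topspace L" and Y: "Y \<in> sets m" "Y \<subseteq> u \<inter> C" for u L m Y
  proof -
    note Eu = fiber_crossings_measurable[OF Tu RD(2) RD(8) u C(2)]
    define P where "P = restrict_space ms (s \<inter> C) \<Otimes>\<^sub>M restrict_space m (u \<inter> C)"
    define Q where "Q = restrict_space \<mu> C"
    define f where "f = tartan_product_map (RS, RU)"
    define W where "W = {p \<in> C. slide RS u p \<in> Y}"
    have PQ: "f \<in> measurable P Q" "the_inv_into ((s \<inter> C) \<times> (u \<inter> C)) f \<in> measurable Q P"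
      "distr P Q f = Q"
      using R(3) su0(1) u Ls unfolding compatible_tartan_def P_def Q_def f_def C_def Let_def
      by fastforce+
    have sp: "space (restrict_space ms (s \<inter> C)) = s \<inter> C" "space (restrict_space m (u \<inter> C)) = u \<inter> C"
      using sets.sets_into_space[OF Es(1)] sets.sets_into_space[OF Eu(1)]
      by (auto simp: space_restrict_space)
    have spP: "space P = (s \<inter> C) \<times> (u \<inter> C)"
      by (simp add: P_def space_pair_measure sp)
    have spQ: "space Q = C"
      by (simp add: Q_def space_restrict_space sp_mu)
    have f_point: "f (x, y) \<in> C \<and> fiber_through RU (f (x, y)) = fiber_through RU x \<and>
        fiber_through RS (f (x, y)) = fiber_through RS y" if "x \<in> C" "y \<in> C" for x y
    proof -
      have "fiber_through RS y \<inter> fiber_through RU x = {f (x, y)}"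
        using RD(5)[OF through(1)[OF that(2)] through(3)[OF that(1)]]
        by (simp add: f_def tartan_product_map_def)
      then have "f (x, y) \<in> fiber_through RS y" "f (x, y) \<in> fiber_through RU x"
        by auto
      then show ?thesis
        using through[OF that(1)] through[OF that(2)] fiber_through_eq[OF RD(3)]
          fiber_through_eq[OF RD(4)] C(1) by blast
    qed
    have cross_mem: "cross u' s' \<in> s' \<inter> u'" if "s' \<in> RS" "u' \<in> RU" for s' u'
      using RD(5)[OF that] by auto
    have cross_uniq: "cross u' s' = p" if "s' \<in> RS" "u' \<in> RU" "p \<in> s'" "p \<in> u'" for s' u' p
      using RD(5)[OF that(1,2)] that(3,4) by (metis IntI singletonD)
    have slide_f: "slide RS u (f (x, y)) = y" if "x \<in> C" "y \<in> u \<inter> C" for x y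
      using f_point[of x y] that cross_uniq[OF through(1) u(1) through(2), of y]
      by (simp add: slide_def)
    have f_inv: "f (cross (fiber_through RU p) s, slide RS u p) = p"
      "cross (fiber_through RU p) s \<in> s \<inter> C" "slide RS u p \<in> u \<inter> C" if "p \<in> C" for p
    proof -
      let ?x = "cross (fiber_through RU p) s" and ?y = "slide RS u p"
      have x: "?x \<in> s \<inter> fiber_through RU p"
        using cross_mem[OF su0(1) through(3)[OF that]] .
      have y: "?y \<in> fiber_through RS p \<inter> u"
        using cross_mem[OF through(1)[OF that] u(1)] by (simp add: slide_def)
      show *: "?x \<in> s \<inter> C" "?y \<in> u \<inter> C"
        using x y through(1,3)[OF that] su0(1) u(1) unfolding C(1) by blast+
      have "fiber_through RU ?x = fiber_through RU p" "fiber_through RS ?y = fiber_through RS p"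
        using fiber_through_eq[OF RD(4) through(3)[OF that]]
          fiber_through_eq[OF RD(3) through(1)[OF that]] x y by blast+
      then have "f (?x, ?y) = cross (fiber_through RU p) (fiber_through RS p)"
        by (simp add: f_def tartan_product_map_def)
      also have "\<dots> = p"
        by (rule cross_uniq[OF through(1)[OF that] through(3)[OF that] through(2)[OF that]
              through(4)[OF that]])
      finally show "f (?x, ?y) = p" .
    qed
    have "inj_on f ((s \<inter> C) \<times> (u \<inter> C))"
    proof (rule inj_onI, clarify)
      fix x y x' y'
      assume xy: "x \<in> s" "x \<in> C" "y \<in> u" "y \<in> C" "x' \<in> s" "x' \<in> C" "y' \<in> u" "y' \<in> C"
        and eq: "f (x, y) = f (x', y')"
      have "y = y'"
        using slide_f[of x y] slide_f[of x' y'] xy eq by simp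
      moreover have "x = cross (fiber_through RU x) s" "x' = cross (fiber_through RU x') s"
        using cross_uniq[OF su0(1) through(3) _ through(4)] xy by simp_all
      ultimately show "x = x' \<and> y = y'"
        using f_point[of x y] f_point[of x' y'] xy eq by metis
    qed
    then have inv: "the_inv_into ((s \<inter> C) \<times> (u \<inter> C)) f p =
        (cross (fiber_through RU p) s, slide RS u p)" if "p \<in> C" for p
      using f_inv[OF that] by (intro the_inv_into_f_eq) auto
    have Y_sets: "Y \<in> sets (restrict_space m (u \<inter> C))"
      using Y Eu(1) by (subst sets_restrict_space_iff) auto
    have "(s \<inter> C) \<times> Y \<in> sets P"
      using Y_sets sets.top[of "restrict_space ms (s \<inter> C)"]
      by (auto simp: P_def sp intro: pair_measureI)
    then have "the_inv_into ((s \<inter> C) \<times> (u \<inter> C)) f -` ((s \<inter> C) \<times> Y) \<inter> space Q \<in> sets Q"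
      using PQ(2) by (rule measurable_sets[rotated])
    also have "the_inv_into ((s \<inter> C) \<times> (u \<inter> C)) f -` ((s \<inter> C) \<times> Y) \<inter> space Q = W"
      using inv f_inv(2) by (auto simp: W_def spQ)
    finally have WQ: "W \<in> sets Q" .
    then have "W \<in> sets borel"
      using C(2) \<mu> unfolding Q_def by (subst (asm) sets_restrict_space_iff) (auto simp: sp_mu)
    moreover have "emeasure \<mu> W = k * emeasure m Y"
    proof -
      have "emeasure \<mu> W = emeasure Q W"
        using C(2) \<mu> unfolding Q_def by (subst emeasure_restrict_space) (auto simp: sp_mu W_def)
      also have "\<dots> = emeasure (distr P Q f) W"
        by (simp add: PQ(3))
      also have "\<dots> = emeasure P (f -` W \<inter> space P)"
        using PQ(1) WQ by (rule emeasure_distr)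
      also have "f -` W \<inter> space P = (s \<inter> C) \<times> Y"
      proof (intro equalityI subrelI)
        show "(x, y) \<in> (s \<inter> C) \<times> Y" if "(x, y) \<in> f -` W \<inter> space P" for x y
          using that slide_f[of x y] by (simp add: W_def spP)
        show "(x, y) \<in> f -` W \<inter> space P" if xy: "(x, y) \<in> (s \<inter> C) \<times> Y" for x y
        proof -
          have "y \<in> u \<inter> C"
            using xy Y(2) by blast
          then show ?thesis
            using xy slide_f[of x y] f_point[of x y] by (simp add: W_def spP)
        qed
      qed
      also have "emeasure P ((s \<inter> C) \<times> Y) =
          emeasure (restrict_space ms (s \<inter> C)) (s \<inter> C) * emeasure (restrict_space m (u \<inter> C)) Y"
      proof -
        have "emeasure (restrict_space m (u \<inter> C)) (u \<inter> C) \<noteq> \<infinity>"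
          using Eu by (subst emeasure_restrict_space) auto
        then interpret Mu: finite_measure "restrict_space m (u \<inter> C)"
          by (intro finite_measureI) (simp add: sp)
        show ?thesis
          unfolding P_def using Y_sets sets.top[of "restrict_space ms (s \<inter> C)"]
          by (intro Mu.emeasure_pair_measure_Times) (auto simp: sp)
      qed
      also have "\<dots> = k * emeasure m Y"
        using Es(1) Eu(1) Y(2) by (simp add: emeasure_restrict_space k_def)
      finally show ?thesis .
    qed
    ultimately show ?thesis
      by (simp add: W_def)
  qed
  have "C = {p \<in> C. slide RS u0 p \<in> u0 \<inter> C}"
  proof (intro equalityI subsetI CollectI conjI)
    fix p assume p: "p \<in> C"
    then have "slide RS u0 p \<in> fiber_through RS p \<inter> u0"
      using RD(5)[OF through(1)[OF p] su0(2)] by (simp add: slide_def)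
    then show "slide RS u0 p \<in> u0 \<inter> C"
      using through(1)[OF p] su0(2) unfolding C(1) by blast
  qed auto
  then have "emeasure \<mu> C = k * emeasure m0 (u0 \<inter> C)"
    using main[OF su0(2) L0 fiber_crossings_measurable(1)[OF Tu RD(2) RD(8) su0(2) L0 C(2)] order_refl]
    by metis
  with C_pos have "0 < k"
    by (metis mult_zero_left zero_less_iff_neq_zero)
  moreover have "k < \<infinity>"
    using Es(2) by (simp add: k_def)
  ultimately show ?thesis
    using main by (rule that)
qed

text \<open>
  Cut one unstable fiber into thirds. The crossings whose stable fiber meets its middle third
  form a set of positive \<open>\<mu>\<close>-measure. On any other unstable fiber the stable fibers meeting
  the outer thirds cross in the same order and, holonomy being measure preserving,
  in sets of the same measure; so they bound from below the length of fiber on both sides of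
  a middle crossing, uniformly in the fiber.
\<close>
lemma middle_crossings:
  assumes Ts: "measured_turbulation \<mu> Ts" and Tu: "measured_turbulation \<mu> Tu"
    and \<mu>: "sets \<mu> = sets borel"
    and R: "is_tartan Ts Tu (RS, RU)" "positive_tartan \<mu> (RS, RU)"
      "compatible_tartan \<mu> Ts Tu (RS, RU)"
  obtains M \<eta> where "M \<in> sets borel" "0 < emeasure \<mu> M" "0 < \<eta>"
    "\<And>p. p \<in> M \<Longrightarrow> \<exists>u\<in>RU. \<exists>L m g a. (L, m) \<in> Tu \<and> u \<subseteq> topspace L \<and> p \<in> u \<and>
       homeomorphic_map euclideanreal L g \<and> g a = p \<and>
       \<eta> \<le> emeasure m (u \<inter> g ` {..a}) \<and> \<eta> \<le> emeasure m (u \<inter> g ` {a..})"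
proof -
  define C where "C = tartan_crossings (RS, RU)"
  note RD = is_tartanD[OF R(1)]
  have C: "C = \<Union>RS \<inter> \<Union>RU" "C \<in> sets borel"
    using RD(6) by (auto simp: C_def tartan_crossings_def)
  obtain k where k: "0 < k" "k < \<infinity>"
    and slide: "\<And>u L m Y. u \<in> RU \<Longrightarrow> (L, m) \<in> Tu \<Longrightarrow> u \<subseteq> topspace L \<Longrightarrow> Y \<in> sets m \<Longrightarrow>
       Y \<subseteq> u \<inter> C \<Longrightarrow> {p \<in> C. slide RS u p \<in> Y} \<in> sets borel \<and>
       emeasure \<mu> {p \<in> C. slide RS u p \<in> Y} = k * emeasure m Y"
    by (rule slide_measure[OF Ts Tu \<mu> R, folded C_def], rule that)
  obtain \<psi> where \<psi>: "orientation Tu RU \<psi>" "same_crossing_order \<psi> RU RS"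
    using RD(9) by blast
  have C_pos: "0 < emeasure \<mu> C"
    using R(2) by (simp add: positive_tartan_def C_def)
  then obtain c where "c \<in> C"
    by (metis all_not_in_conv emeasure_empty less_irrefl)
  then obtain u0 where u0: "u0 \<in> RU" "c \<in> u0"
    using C(1) by auto
  have fiberE: "\<exists>L m. (L, m) \<in> Tu \<and> u \<subseteq> topspace L \<and> homeomorphic_map euclideanreal L (\<psi> u)"
    if "u \<in> RU" for u
    using \<psi>(1) that unfolding orientation_def by blast
  obtain L0 m0 where L0: "(L0, m0) \<in> Tu" "u0 \<subseteq> topspace L0"
    and g0: "homeomorphic_map euclideanreal L0 (\<psi> u0)"
    using fiberE[OF u0(1)] by blast
  have m0: "stream_measure L0 m0"
    using Tu L0(1) by (auto simp: measured_turbulation_def)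
  have through: "fiber_through RS p \<in> RS" "p \<in> fiber_through RS p" if "p \<in> C" for p
    using that C(1) fiber_through_eq[OF RD(3)] by auto
  have slide_mem: "slide RS u p \<in> fiber_through RS p \<inter> u" "slide RS u p \<in> C"
    if "u \<in> RU" "p \<in> C" for u p
  proof -
    show *: "slide RS u p \<in> fiber_through RS p \<inter> u"
      using RD(5)[OF through(1)[OF that(2)] that(1)] by (simp add: slide_def)
    show "slide RS u p \<in> C"
      using * through(1)[OF that(2)] that(1) unfolding C(1) by blast
  qed
  have slide_slide: "slide RS u' (slide RS u p) = slide RS u' p" if "u \<in> RU" "p \<in> C" for u u' p
    using fiber_through_eq[OF RD(3) through(1)[OF that(2)]] slide_mem(1)[OF that]
    by (simp add: slide_def)
  have slide_id: "slide RS u p = p" if "u \<in> RU" "p \<in> C" "p \<in> u" for u p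
    using RD(5)[OF through(1)[OF that(2)] that(1)] through(2)[OF that(2)] that(3)
    unfolding slide_def by (metis IntI singletonD)
  define E where "E = u0 \<inter> C"
  have E: "E \<in> sets m0" "emeasure m0 E < \<infinity>"
    using fiber_crossings_measurable[OF Tu RD(2) RD(8) u0(1) L0 C(2)] by (auto simp: E_def)
  have "{p \<in> C. slide RS u0 p \<in> E} = C"
    using slide_mem[OF u0(1)] by (auto simp: E_def)
  then have "emeasure \<mu> C = k * emeasure m0 E"
    using slide[OF u0(1) L0 E(1)] by (simp add: E_def)
  with C_pos have "0 < emeasure m0 E"
    by (metis mult_zero_right zero_less_iff_neq_zero)
  then obtain t t' where thirds: "0 < emeasure m0 (E \<inter> \<psi> u0 ` {..t})"
      "0 < emeasure m0 (E \<inter> \<psi> u0 ` {t<..t'})" "0 < emeasure m0 (E \<inter> \<psi> u0 ` {t'<..})"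
    using stream_measure_thirds[OF g0 m0 E(1)] E(2) by blast
  have piece: "E \<inter> \<psi> u0 ` S \<in> sets m0" if "S \<in> sets borel" for S
    using homeomorphic_map_image_borel_of[OF g0, of S] that E(1)
      stream_measure_space_sets(2)[OF m0] by (auto simp: borel_of_euclidean)
  define \<Gamma> where "\<Gamma> S = {p \<in> C. slide RS u0 p \<in> E \<inter> \<psi> u0 ` S}" for S
  have \<Gamma>: "\<Gamma> S \<in> sets borel" "emeasure \<mu> (\<Gamma> S) = k * emeasure m0 (E \<inter> \<psi> u0 ` S)"
    if "S \<in> sets borel" for S
    using slide[OF u0(1) L0 piece[OF that]] by (auto simp: \<Gamma>_def E_def)
  (* On either fiber the preimage of the respective piece under the slide is \<Gamma> S, so slide_measure
     evaluates the \<mu>-measure of \<Gamma> S in two ways with the same factor k. *)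
  have transfer: "emeasure m (u \<inter> \<Gamma> S) = emeasure m0 (E \<inter> \<psi> u0 ` S)"
    if u: "u \<in> RU" "(L, m) \<in> Tu" "u \<subseteq> topspace L" and S: "S \<in> sets borel" for u L m S
  proof -
    have "u \<inter> \<Gamma> S \<in> sets m"
      using fiber_crossings_measurable(1)[OF Tu RD(2) RD(8) u \<Gamma>(1)[OF S]] .
    moreover have "u \<inter> \<Gamma> S \<subseteq> u \<inter> C"
      by (auto simp: \<Gamma>_def)
    moreover have "{p \<in> C. slide RS u p \<in> u \<inter> \<Gamma> S} = \<Gamma> S"
      using slide_mem[OF u(1)] slide_slide[OF u(1)] by (auto simp: \<Gamma>_def)
    ultimately have "k * emeasure m (u \<inter> \<Gamma> S) = k * emeasure m0 (E \<inter> \<psi> u0 ` S)"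
      using slide[OF u, of "u \<inter> \<Gamma> S"] \<Gamma>(2)[OF S] by simp
    then show ?thesis
      using k by (auto simp: ennreal_mult_cancel_left)
  qed
  have order: "a < b"
    if u: "u \<in> RU" "homeomorphic_map euclideanreal L (\<psi> u)"
      and pq: "p \<in> C" "q \<in> C" "p \<in> u" "q \<in> u" "\<psi> u a = p" "\<psi> u b = q"
      and lt: "slide RS u0 p = \<psi> u0 x" "slide RS u0 q = \<psi> u0 y" "x < y" for u L p q a b x y
  proof -
    have "before (\<psi> u0) (slide RS u0 p) (slide RS u0 q)"
      using lt by (auto simp: before_def)
    then have "before (\<psi> u) (slide RS u p) (slide RS u q)"
      using \<psi>(2) u0(1) u(1) through(1)[OF pq(1)] through(1)[OF pq(2)]
      unfolding same_crossing_order_def slide_def by blast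
    then have "before (\<psi> u) p q"
      using slide_id u(1) pq by simp
    moreover have "inj (\<psi> u)"
      using homeomorphic_imp_injective_map[OF u(2)] by simp
    ultimately show ?thesis
      using pq(5,6) by (metis before_def injD)
  qed
  define \<eta> where "\<eta> = min (emeasure m0 (E \<inter> \<psi> u0 ` {..t})) (emeasure m0 (E \<inter> \<psi> u0 ` {t'<..}))"
  show ?thesis
  proof (rule that[of "\<Gamma> {t<..t'}" \<eta>])
    show "\<Gamma> {t<..t'} \<in> sets borel" "0 < emeasure \<mu> (\<Gamma> {t<..t'})"
      using \<Gamma>[of "{t<..t'}"] thirds(2) k(1) by (auto simp: ennreal_zero_less_mult_iff)
    show "0 < \<eta>"
      using thirds by (simp add: \<eta>_def)
    fix p assume p: "p \<in> \<Gamma> {t<..t'}"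
    then have pC: "p \<in> C"
      by (simp add: \<Gamma>_def)
    obtain y where y: "slide RS u0 p = \<psi> u0 y" "t < y" "y \<le> t'"
      using p by (auto simp: \<Gamma>_def)
    obtain u where u: "u \<in> RU" "p \<in> u"
      using pC C(1) by auto
    obtain L m where L: "(L, m) \<in> Tu" "u \<subseteq> topspace L"
      and g: "homeomorphic_map euclideanreal L (\<psi> u)"
      using fiberE[OF u(1)] by blast
    have m: "stream_measure L m"
      using Tu L(1) by (auto simp: measured_turbulation_def)
    have on_u: "\<exists>b. \<psi> u b = q" if "q \<in> u" for q
    proof -
      have "q \<in> range (\<psi> u)"
        using that L(2) homeomorphic_imp_surjective_map[OF g] by auto
      then show ?thesis by auto
    qed
    obtain a where a: "\<psi> u a = p"
      using on_u u(2) by blast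
    have u_sets: "u \<in> sets (borel_of L)"
      using connectedin_line_borel[OF g fiber_connected[OF Tu RD(2) u(1) L]] .
    have ray_sets: "u \<inter> \<psi> u ` S \<in> sets m" if "S \<in> sets borel" for S
      using homeomorphic_map_image_borel_of[OF g, of S] that u_sets
        stream_measure_space_sets(2)[OF m] by (auto simp: borel_of_euclidean)
    have "u \<inter> \<Gamma> {..t} \<subseteq> u \<inter> \<psi> u ` {..a}"
    proof
      fix q assume q: "q \<in> u \<inter> \<Gamma> {..t}"
      then obtain x where x: "slide RS u0 q = \<psi> u0 x" "x \<le> t" "q \<in> C" "q \<in> u"
        by (auto simp: \<Gamma>_def)
      obtain b where b: "\<psi> u b = q"
        using on_u x(4) by blast
      have "b < a"
        using order[OF u(1) g x(3) pC x(4) u(2) b a x(1) y(1)] x(2) y(2) by simp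
      then show "q \<in> u \<inter> \<psi> u ` {..a}"
        using b x(4) by auto
    qed
    then have "\<eta> \<le> emeasure m (u \<inter> \<psi> u ` {..a})"
      using emeasure_mono[OF _ ray_sets, of "u \<inter> \<Gamma> {..t}" "{..a}"]
        transfer[OF u(1) L, of "{..t}"] by (simp add: \<eta>_def min.coboundedI1)
    moreover have "u \<inter> \<Gamma> {t'<..} \<subseteq> u \<inter> \<psi> u ` {a..}"
    proof
      fix q assume q: "q \<in> u \<inter> \<Gamma> {t'<..}"
      then obtain x where x: "slide RS u0 q = \<psi> u0 x" "t' < x" "q \<in> C" "q \<in> u"
        by (auto simp: \<Gamma>_def)
      obtain b where b: "\<psi> u b = q"
        using on_u x(4) by blast
      have "a < b"
        using order[OF u(1) g pC x(3) u(2) x(4) a b y(1) x(1)] x(2) y(3) by simp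
      then show "q \<in> u \<inter> \<psi> u ` {a..}"
        using b x(4) by auto
    qed
    then have "\<eta> \<le> emeasure m (u \<inter> \<psi> u ` {a..})"
      using emeasure_mono[OF _ ray_sets, of "u \<inter> \<Gamma> {t'<..}" "{a..}"]
        transfer[OF u(1) L, of "{t'<..}"] by (simp add: \<eta>_def min.coboundedI2)
    ultimately show "\<exists>u\<in>RU. \<exists>L m g a. (L, m) \<in> Tu \<and> u \<subseteq> topspace L \<and> p \<in> u \<and>
       homeomorphic_map euclideanreal L g \<and> g a = p \<and>
       \<eta> \<le> emeasure m (u \<inter> g ` {..a}) \<and> \<eta> \<le> emeasure m (u \<inter> g ` {a..})"
      using u L g a by blast
  qed
qed

section \<open>Iterating the map\<close>

lemma homeomorphic_map_image_topology:
  assumes "inj F"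
  shows "homeomorphic_map L (image_topology F L) F"
proof -
  let ?G = "the_inv_into (topspace L) F"
  have inv: "?G (F x) = x" if "x \<in> topspace L" for x
    using the_inv_into_f_f[OF inj_on_subset[OF assms subset_UNIV] that] .
  have top: "topspace (image_topology F L) = F ` topspace L"
    using inv by (auto simp: image_topology_def topspace_pullback_topology)
  have "continuous_map L (image_topology F L) F"
    unfolding image_topology_def
  proof (rule continuous_map_pullback')
    show "continuous_map L L (?G \<circ> F)"
      using continuous_map_eq[OF continuous_map_id[of L], of "?G \<circ> F"] inv by simp
  qed auto
  moreover have "continuous_map (image_topology F L) L ?G"
    using continuous_map_pullback[OF continuous_map_id[of L], of "F ` topspace L" ?G]
    by (simp add: image_topology_def)
  ultimately have "homeomorphic_maps L (image_topology F L) F ?G"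
    using inv by (auto simp: homeomorphic_maps_def top)
  then show ?thesis
    using homeomorphic_map_maps by blast
qed

text \<open>
  The equation of turbulations says which streamlines occur, not which one is the image of \<open>L\<close>;
  the line \<open>L'\<close> is found by looking up the image of \<open>(L, m)\<close> in the scaled turbulation.
\<close>
lemma scaled_image_step:
  assumes T: "measured_turbulation \<mu> T" and F: "inj F"
    and eq: "image_turbulation F T = scale_turbulation c T" and L: "(L, m) \<in> T"
  obtains L' m' where "(L', m') \<in> T" "homeomorphic_map L L' F"
    "\<And>Y. Y \<in> sets m \<Longrightarrow> emeasure m Y = ennreal c * emeasure m' (F ` Y)"
proof -
  have m: "stream_measure L m"
    using T L by (auto simp: measured_turbulation_def)
  note sm = stream_measure_space_sets[OF m]
  note hom = homeomorphic_map_image_topology[OF F, of L]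
  have "(image_topology F L, distr m (borel_of (image_topology F L)) F) \<in> image_turbulation F T"
    unfolding image_turbulation_def using L by (force intro: image_eqI)
  then obtain L' m' where L': "(L', m') \<in> T" "L' = image_topology F L"
    and m': "distr m (borel_of (image_topology F L)) F = scale_measure (ennreal c) m'"
    unfolding eq scale_turbulation_def by auto
  have F_meas: "F \<in> measurable m (borel_of (image_topology F L))"
    using measurable_borel_of[OF homeomorphic_imp_continuous_map[OF hom]]
    by (simp cong: measurable_cong_sets add: sm(2))
  have "emeasure m Y = ennreal c * emeasure m' (F ` Y)" if Y: "Y \<in> sets m" for Y
  proof -
    have FY: "F ` Y \<in> sets (borel_of (image_topology F L))"
      using homeomorphic_map_image_borel_of[OF hom] Y sm(2) by simp
    have "F -` F ` Y \<inter> space m = Y"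
      using F sets.sets_into_space[OF Y] by (auto simp: inj_vimage_image_eq)
    then have "emeasure m Y = emeasure (distr m (borel_of (image_topology F L)) F) (F ` Y)"
      using emeasure_distr[OF F_meas FY] by simp
    then show ?thesis
      by (simp add: m')
  qed
  then show ?thesis
    using that L' hom by blast
qed

text \<open>
  For the unstable turbulation \<open>c\<close> is the inverse of the dilatation, and the equation says that
  the \<open>n\<close>-th iterate stretches unstable arcs by the \<open>n\<close>-th power of the dilatation.
\<close>
lemma scaled_image_iterate:
  assumes T: "measured_turbulation \<mu> T" and F: "inj F" and c: "0 \<le> c"
    and eq: "image_turbulation F T = scale_turbulation c T" and L: "(L, m) \<in> T"
  shows "\<exists>L' m'. (L', m') \<in> T \<and> homeomorphic_map L L' (F ^^ n) \<and>
    (\<forall>Y\<in>sets m. emeasure m Y = ennreal (c ^ n) * emeasure m' ((F ^^ n) ` Y))"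
proof (induction n)
  case 0
  show ?case
  proof (intro exI conjI)
    have "F ^^ 0 = id" by auto
    then show "homeomorphic_map L L (F ^^ 0)" by simp
  qed (use L in auto)
next
  case (Suc n)
  then obtain L1 m1 where L1: "(L1, m1) \<in> T" "homeomorphic_map L L1 (F ^^ n)"
    and m1: "\<And>Y. Y \<in> sets m \<Longrightarrow> emeasure m Y = ennreal (c ^ n) * emeasure m1 ((F ^^ n) ` Y)"
    by blast
  obtain L' m' where L': "(L', m') \<in> T" "homeomorphic_map L1 L' F"
    and m': "\<And>Y. Y \<in> sets m1 \<Longrightarrow> emeasure m1 Y = ennreal c * emeasure m' (F ` Y)"
    by (rule scaled_image_step[OF T F eq L1(1)], rule that)
  have "stream_measure L m" "stream_measure L1 m1"
    using T L L1(1) by (auto simp: measured_turbulation_def)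
  note sm = stream_measure_space_sets(2)[OF this(1)] stream_measure_space_sets(2)[OF this(2)]
  have "emeasure m Y = ennreal (c ^ Suc n) * emeasure m' ((F ^^ Suc n) ` Y)" if Y: "Y \<in> sets m" for Y
  proof -
    have "(F ^^ n) ` Y \<in> sets m1"
      using homeomorphic_map_image_borel_of[OF L1(2)] Y sm by simp
    from m'[OF this] m1[OF Y] show ?thesis
      using c by (simp add: image_comp ennreal_mult'' mult.assoc mult.commute[of c] mult.left_commute)
  qed
  moreover have "homeomorphic_map L L' (F ^^ Suc n)"
    using homeomorphic_map_compose[OF L1(2) L'(2)] by simp
  ultimately show ?case
    using L'(1) by blast
qed

lemma emeasure_iterate_image:
  assumes F: "homeomorphism UNIV UNIV F G" and \<mu>: "sets \<mu> = sets borel" and inv: "distr \<mu> \<mu> F = \<mu>"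
    and S: "S \<in> sets borel"
  shows "(F ^^ n) ` S \<in> sets borel \<and> emeasure \<mu> ((F ^^ n) ` S) = emeasure \<mu> S"
proof (induction n)
  case 0
  then show ?case using S by simp
next
  case (Suc n)
  let ?S = "(F ^^ n) ` S"
  have GF: "G (F x) = x" "F (G x) = x" for x
    using F by (auto simp: homeomorphism_def)
  have img: "F ` ?S = G -` ?S"
  proof (intro equalityI subsetI)
    show "x \<in> F ` ?S" if "x \<in> G -` ?S" for x
      using that GF(2)[of x] by (metis imageI vimageE)
  qed (use GF in auto)
  have FG_meas: "F \<in> borel_measurable borel" "G \<in> borel_measurable borel"
    using F by (auto simp: homeomorphism_def intro: borel_measurable_continuous_onI)
  have FS: "F ` ?S \<in> sets borel"
    using measurable_sets[OF FG_meas(2), of ?S] Suc by (simp add: img)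
  have "F \<in> measurable \<mu> \<mu>"
    using FG_meas(1) by (simp cong: measurable_cong_sets add: \<mu>)
  then have "emeasure \<mu> (F ` ?S) = emeasure \<mu> (F -` F ` ?S \<inter> space \<mu>)"
    using emeasure_distr[of F \<mu> \<mu> "F ` ?S"] FS by (simp add: inv \<mu>)
  also have "F -` F ` ?S \<inter> space \<mu> = ?S"
    using inj_vimage_image_eq[OF inj_on_inverseI[of UNIV G F], of ?S] GF(1)
      sets_eq_imp_space_eq[OF \<mu>] by simp
  finally show ?case
    using Suc FS by (simp add: image_comp)
qed

text \<open>
  The upper limit of the sets is a decreasing intersection of unions, each of measure at least \<open>c\<close>;
  the space being finite, it has measure at least \<open>c\<close> itself.
\<close>
lemma frequently_in_sets_of_large_measure:
  assumes fin: "emeasure M (space M) < \<infinity>" and A: "\<And>n::nat. A n \<in> sets M"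
    and c: "0 < c" "\<And>n. c \<le> emeasure M (A n)"
  shows "\<exists>x. \<exists>\<^sub>\<infinity>n. x \<in> A n"
proof -
  define B where "B n = (\<Union>k\<in>{n..}. A k)" for n
  have B: "range B \<subseteq> sets M" "decseq B"
    using A by (fastforce simp: B_def decseq_def)+
  have "emeasure M (B n) \<noteq> \<infinity>" for n
    using fin emeasure_space[of M "B n"] by (auto simp: top_unique)
  then have "(INF n. emeasure M (B n)) = emeasure M (\<Inter>n. B n)"
    using B by (intro INF_emeasure_decseq) auto
  moreover have "c \<le> emeasure M (B n)" for n
  proof -
    have "emeasure M (A n) \<le> emeasure M (B n)"
      using B(1) by (intro emeasure_mono) (auto simp: B_def)
    then show ?thesis
      using c(2)[of n] by (rule order_trans[rotated])
  qed
  ultimately have "c \<le> emeasure M (\<Inter>n. B n)"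
    by (metis INF_greatest)
  with c(1) have "(\<Inter>n. B n) \<noteq> {}"
    by auto
  then obtain x where "\<And>n. x \<in> B n" by auto
  then have "\<exists>\<^sub>\<infinity>n. x \<in> A n"
    by (fastforce simp: INFM_nat_le B_def)
  then show ?thesis by blast
qed


section \<open>Sensitive dependence\<close>

text \<open>
  Both ends of \<open>v\<close> are farther from \<open>p\<close>, in measure, than \<open>q\<close> is; so they lie beyond \<open>q\<close>,
  whichever side of \<open>p\<close> it is on.
\<close>
lemma long_arc_reaches:
  assumes g: "homeomorphic_map euclideanreal L g" and m: "stream_measure L m"
    and v: "connectedin L v" "g a \<in> v"
    and S: "connectedin L S" "g a \<in> S" "q \<in> S"
    and long: "emeasure m S < emeasure m (v \<inter> g ` {..a})" "emeasure m S < emeasure m (v \<inter> g ` {a..})"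
  shows "q \<in> v"
proof (rule ccontr)
  assume q: "q \<notin> v"
  have "q \<in> topspace L"
    using S(1,3) connectedin_subset_topspace by blast
  then have "q \<in> range g"
    using homeomorphic_imp_surjective_map[OF g] by simp
  then obtain b where b: "g b = q"
    by auto
  have conv: "z \<in> g -` A" if "connectedin L A" "x \<in> g -` A" "y \<in> g -` A" "x \<le> z" "z \<le> y" for A x y z
    using connectedin_line_preimage[OF g that(1)] that(2-) unfolding is_interval_1 by blast
  have S_sets: "S \<in> sets m"
    using connectedin_line_borel[OF g S(1)] stream_measure_space_sets(2)[OF m] by simp
  have "v \<inter> g ` {..a} \<subseteq> S \<or> v \<inter> g ` {a..} \<subseteq> S"
  proof (cases "a \<le> b")
    case True
    have "g z \<in> S" if "g z \<in> v" "a \<le> z" for z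
    proof -
      have "z \<le> b"
        using conv[OF v(1), of a z b] v(2) that q b True by fastforce
      then show ?thesis
        using conv[OF S(1), of a b z] S b that by auto
    qed
    then show ?thesis by auto
  next
    case False
    have "g z \<in> S" if "g z \<in> v" "z \<le> a" for z
    proof -
      have "b \<le> z"
        using conv[OF v(1), of z a b] v(2) that q b False by fastforce
      then show ?thesis
        using conv[OF S(1), of b a z] S b that by auto
    qed
    then show ?thesis by auto
  qed
  then show False
    using emeasure_mono[OF _ S_sets] long by (meson not_less)
qed

theorem mainTheorem4:
  fixes \<mu> :: "'a::{t2_space, second_countable_topology} measure"
    and F :: "'a \<Rightarrow> 'a"
    and d :: "'a \<Rightarrow> 'a \<Rightarrow> real"
  assumes "compact_surface TYPE('a)"
    and "oxtoby_ulam euclidean surface_boundary \<mu>"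
    and "emeasure \<mu> UNIV = 1"
    and "measurable_pseudo_Anosov \<mu> F"
    and "compatible_metric d"
  shows "\<exists>\<delta>>0. \<forall>x N. x \<in> interior N \<longrightarrow>
           (\<exists>y\<in>N. \<exists>n. d ((F ^^ n) x) ((F ^^ n) y) > \<delta>)"
proof -
  have \<mu>: "sets \<mu> = sets borel"
    using assms(2) by (simp add: oxtoby_ulam_def borel_of_euclidean)
  then have sp_mu: "space \<mu> = UNIV"
    using sets_eq_imp_space_eq by fastforce
  obtain G Ts Tu lam where F: "homeomorphism UNIV UNIV F G" "distr \<mu> \<mu> F = \<mu>"
    and pA: "pseudo_Anosov_turbulations \<mu> Ts Tu" and lam: "lam > 1"
    and scale: "image_turbulation F Tu = scale_turbulation (inverse lam) Tu"
    using assms(4) unfolding measurable_pseudo_Anosov_def by blast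
  have Ts: "measured_turbulation \<mu> Ts" and Tu: "measured_turbulation \<mu> Tu"
    and full: "full_pair \<mu> Ts Tu" and dense: "dense_streamlines Tu"
    using pA by (auto simp: pseudo_Anosov_turbulations_def transverse_pair_def)
  have injF: "inj F"
    using F(1) by (metis homeomorphism_def UNIV_I injI)
  have inj_iter: "inj (F ^^ n)" for n
    using injF by (rule inj_fn)
  have inv_lam: "0 \<le> inverse lam" "0 < inverse lam" "inverse lam < 1"
    using lam by (simp_all add: inverse_less_1_iff)
  interpret d: Metric_space UNIV d
    using assms(5) by (simp add: compatible_metric_def)
  have metric_top: "d.mtopology = euclidean"
    using assms(5) by (simp add: compatible_metric_def)
  have good: "\<exists>RS RU. is_tartan Ts Tu (RS, RU) \<and> positive_tartan \<mu> (RS, RU) \<and>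
      compatible_tartan \<mu> Ts Tu (RS, RU) \<and> \<Union>RU \<subseteq> U" if "open U" "U \<noteq> {}" for U
  proof -
    obtain R where "is_tartan Ts Tu R" "positive_tartan \<mu> R" "compatible_tartan \<mu> Ts Tu R"
      "\<Union>(fst R) \<union> \<Union>(snd R) \<subseteq> U"
      using full \<open>open U\<close> \<open>U \<noteq> {}\<close> unfolding full_pair_def Let_def by blast
    then show ?thesis
      by (intro exI[of _ "fst R"] exI[of _ "snd R"]) simp
  qed
  have line: "\<exists>h. homeomorphic_map euclideanreal L h" if "(L, m) \<in> Tu" for L m
  proof -
    have "immersed_line L"
      using Tu that by (auto simp: measured_turbulation_def)
    then show ?thesis
      by (metis immersed_line_def homeomorphic_space homeomorphic_space_sym)
  qed
  have "\<exists>e e' :: 'a. e \<noteq> e'"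
  proof -
    obtain RS RU where R: "is_tartan Ts Tu (RS, RU)" "positive_tartan \<mu> (RS, RU)"
      using good[of UNIV] by auto
    have "tartan_crossings (RS, RU) \<noteq> {}"
      using R(2) by (auto simp: positive_tartan_def)
    then obtain u where "u \<in> RU"
      by (auto simp: tartan_crossings_def)
    then obtain L m where "(L, m) \<in> Tu"
      using fiber_carrier[OF is_tartanD(2)[OF R(1)]] by metis
    then obtain h where "homeomorphic_map euclideanreal L h"
      using line by blast
    then have "inj h"
      using homeomorphic_imp_injective_map by fastforce
    then have "h 0 \<noteq> h 1"
      by (metis injD zero_neq_one)
    then show ?thesis by blast
  qed
  then obtain e e' :: 'a where "e \<noteq> e'"
    by blast
  (* The closed ball of radius 2 \<delta> around z will turn out to be dense; with the slack taken in the
     closure argument every point is within 3 \<delta> of z, and 6 \<delta> is still less than d e e'. *)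
  define \<delta> where "\<delta> = d e e' / 8"
  have \<delta>: "0 < \<delta>"
    using \<open>e \<noteq> e'\<close> by (simp add: \<delta>_def)
  have "\<exists>y\<in>N. \<exists>n. d ((F ^^ n) x) ((F ^^ n) y) > \<delta>" if x: "x \<in> interior N" for x N
  proof (rule ccontr)
    assume "\<not> ?thesis"
    then have close: "d ((F ^^ n) x) ((F ^^ n) y) \<le> \<delta>" if "y \<in> interior N" for y n
      using that interior_subset by (meson not_le subset_iff)
    obtain RS RU where R: "is_tartan Ts Tu (RS, RU)" "positive_tartan \<mu> (RS, RU)"
      "compatible_tartan \<mu> Ts Tu (RS, RU)" and RU: "\<Union>RU \<subseteq> interior N"
      using good[of "interior N"] x by auto
    obtain M \<eta> where M: "M \<in> sets borel" "0 < emeasure \<mu> M" "0 < \<eta>"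
      and middle: "\<And>p. p \<in> M \<Longrightarrow> \<exists>u\<in>RU. \<exists>L m g a. (L, m) \<in> Tu \<and> u \<subseteq> topspace L \<and> p \<in> u \<and>
        homeomorphic_map euclideanreal L g \<and> g a = p \<and>
        \<eta> \<le> emeasure m (u \<inter> g ` {..a}) \<and> \<eta> \<le> emeasure m (u \<inter> g ` {a..})"
      by (rule middle_crossings[OF Ts Tu \<mu> R], rule that)
    have "\<exists>z. \<exists>\<^sub>\<infinity>n. z \<in> (F ^^ n) ` M"
      using emeasure_iterate_image[OF F(1) \<mu> F(2) M(1)] assms(3) M(2) \<mu>
      by (intro frequently_in_sets_of_large_measure[of \<mu> _ "emeasure \<mu> M"]) (auto simp: sp_mu)
    then obtain z where z: "\<exists>\<^sub>\<infinity>n. z \<in> (F ^^ n) ` M"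
      by blast
    have visit: "\<exists>v L m g a. (L, m) \<in> Tu \<and> connectedin L v \<and> z \<in> v \<and> v \<subseteq> (F ^^ n) ` interior N \<and>
        homeomorphic_map euclideanreal L g \<and> g a = z \<and>
        \<eta> \<le> ennreal (inverse lam ^ n) * emeasure m (v \<inter> g ` {..a}) \<and>
        \<eta> \<le> ennreal (inverse lam ^ n) * emeasure m (v \<inter> g ` {a..})"
      if hit: "z \<in> (F ^^ n) ` M" for n
    proof -
      obtain p where p: "p \<in> M" "z = (F ^^ n) p"
        using hit by blast
      obtain u L m g a where u: "u \<in> RU" "(L, m) \<in> Tu" "u \<subseteq> topspace L" "p \<in> u"
        and g: "homeomorphic_map euclideanreal L g" "g a = p"
        and long: "\<eta> \<le> emeasure m (u \<inter> g ` {..a})" "\<eta> \<le> emeasure m (u \<inter> g ` {a..})"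
        using middle[OF p(1)] by blast
      have m: "stream_measure L m"
        using Tu u(2) by (auto simp: measured_turbulation_def)
      obtain L' m' where L': "(L', m') \<in> Tu" "homeomorphic_map L L' (F ^^ n)"
        and m': "\<And>Y. Y \<in> sets m \<Longrightarrow>
          emeasure m Y = ennreal (inverse lam ^ n) * emeasure m' ((F ^^ n) ` Y)"
        using scaled_image_iterate[OF Tu injF inv_lam(1) scale u(2), of n] by blast
      have u_conn: "connectedin L u"
        using fiber_connected[OF Tu is_tartanD(2)[OF R(1)] u(1-3)] .
      have ray: "emeasure m (u \<inter> g ` S) =
          ennreal (inverse lam ^ n) * emeasure m' ((F ^^ n) ` u \<inter> ((F ^^ n) \<circ> g) ` S)"
        if "S \<in> sets borel" for S
      proof -
        have "u \<inter> g ` S \<in> sets m"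
          using connectedin_line_borel[OF g(1) u_conn] that
            homeomorphic_map_image_borel_of[OF g(1), of S] stream_measure_space_sets(2)[OF m]
          by (auto simp: borel_of_euclidean)
        from m'[OF this] show ?thesis
          by (simp add: image_Int[OF inj_iter] image_comp)
      qed
      show ?thesis
      proof (intro exI conjI)
        show "(L', m') \<in> Tu" by (rule L')
        show "connectedin L' ((F ^^ n) ` u)"
          using connectedin_continuous_map_image[OF homeomorphic_imp_continuous_map[OF L'(2)] u_conn] .
        show "homeomorphic_map euclideanreal L' ((F ^^ n) \<circ> g)"
          using homeomorphic_map_compose[OF g(1) L'(2)] .
        show "z \<in> (F ^^ n) ` u" "((F ^^ n) \<circ> g) a = z"
          using p(2) u(4) g(2) by auto
        show "(F ^^ n) ` u \<subseteq> (F ^^ n) ` interior N"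
          using RU u(1) by blast
        show "\<eta> \<le> ennreal (inverse lam ^ n) * emeasure m' ((F ^^ n) ` u \<inter> ((F ^^ n) \<circ> g) ` {..a})"
          "\<eta> \<le> ennreal (inverse lam ^ n) * emeasure m' ((F ^^ n) ` u \<inter> ((F ^^ n) \<circ> g) ` {a..})"
          using long ray by simp_all
      qed
    qed
    obtain n0 where "z \<in> (F ^^ n0) ` M"
      using frequently_ex[OF z] by blast
    (* Streamlines are disjoint, so the arcs found at later visits all lie in the line L. *)
    from visit[OF this] obtain L m v0 where L: "(L, m) \<in> Tu" and v0: "connectedin L v0" "z \<in> v0"
      by blast
    have zL: "z \<in> topspace L"
      using v0 connectedin_subset_topspace by blast
    have m: "stream_measure L m"
      using Tu L by (auto simp: measured_turbulation_def)
    have near: "d z q \<le> 2 * \<delta>" if q: "q \<in> topspace L" for q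
    proof -
      obtain h where h: "homeomorphic_map euclideanreal L h"
        using line[OF L] by blast
      have "z \<in> range h" "q \<in> range h"
        using zL q homeomorphic_imp_surjective_map[OF h] by simp_all
      then obtain t t' where t: "h t = z" "h t' = q"
        by auto
      define r where "r = max \<bar>t\<bar> \<bar>t'\<bar> + 1"
      define S where "S = h ` {-r..r}"
      have "- r < r"
        by (simp add: r_def)
      then have "closed_arc L (h (- r)) (h r) S"
        using h unfolding closed_arc_def S_def by blast
      then have fin: "emeasure m S < \<infinity>"
        using m by (auto simp: stream_measure_def)
      have "t \<in> {-r..r}" "t' \<in> {-r..r}"
        by (auto simp: r_def)
      then have S: "connectedin L S" "z \<in> S" "q \<in> S"
        using connectedin_continuous_map_image[OF homeomorphic_imp_continuous_map[OF h], of "{-r..r}"] t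
        by (auto simp: S_def)
      obtain K where K: "emeasure m S = ennreal K" "0 \<le> K"
        using fin by (cases "emeasure m S") auto
      have "(\<lambda>n. inverse lam ^ n * K) \<longlonglongrightarrow> 0"
        using inv_lam by (intro tendsto_mult_left_zero LIMSEQ_power_zero) auto
      then have "(\<lambda>n. ennreal (inverse lam ^ n * K)) \<longlonglongrightarrow> 0"
        using tendsto_ennrealI by fastforce
      then have "\<forall>\<^sub>F n in sequentially. ennreal (inverse lam ^ n * K) < \<eta>"
        using M(3) by (rule order_tendstoD(2))
      then have "\<forall>\<^sub>F n in sequentially. ennreal (inverse lam ^ n) * emeasure m S < \<eta>"
        using K inv_lam by (simp add: ennreal_mult)
      then obtain n where n: "z \<in> (F ^^ n) ` M" "ennreal (inverse lam ^ n) * emeasure m S < \<eta>"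
        using frequently_eventually_frequently[OF z] frequently_ex
        unfolding cofinite_eq_sequentially by blast
      obtain v L1 m1 g a where v: "(L1, m1) \<in> Tu" "connectedin L1 v" "z \<in> v"
          "v \<subseteq> (F ^^ n) ` interior N"
        and g: "homeomorphic_map euclideanreal L1 g" "g a = z"
        and long: "\<eta> \<le> ennreal (inverse lam ^ n) * emeasure m1 (v \<inter> g ` {..a})"
          "\<eta> \<le> ennreal (inverse lam ^ n) * emeasure m1 (v \<inter> g ` {a..})"
        using visit[OF n(1)] by blast
      have "z \<in> topspace L1"
        using v(2,3) connectedin_subset_topspace by blast
      then have L1: "L1 = L" "m1 = m"
        using streamline_unique[OF Tu v(1) L] zL by simp_all
      have "emeasure m S < emeasure m (v \<inter> g ` {..a})" "emeasure m S < emeasure m (v \<inter> g ` {a..})"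
        using less_le_trans[OF n(2)] long unfolding L1 by (meson mult_left_mono not_le zero_le)+
      then have "q \<in> v"
        using long_arc_reaches[of L g m v a S q] g v(2,3) m S unfolding L1 by simp
      then obtain y y' where "y \<in> interior N" "q = (F ^^ n) y" "y' \<in> interior N" "z = (F ^^ n) y'"
        using v(3,4) by blast
      then show ?thesis
        using close[of y n] close[of y' n] d.triangle[of z "(F ^^ n) x" q] d.commute[of z "(F ^^ n) x"]
        by simp
    qed
    have "d z q < 3 * \<delta>" for q
    proof -
      have "open (d.mball q \<delta>)"
        using d.openin_mball[of q \<delta>] unfolding metric_top by simp
      moreover have "q \<in> d.mball q \<delta>"
        using \<delta> by simp
      moreover have "closure (topspace L) = UNIV"
        using dense L by (auto simp: dense_streamlines_def)
      ultimately have "d.mball q \<delta> \<inter> topspace L \<noteq> {}"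
        using open_Int_closure_eq_empty[of "d.mball q \<delta>" "topspace L"] by blast
      then obtain w where "w \<in> topspace L" "d q w < \<delta>"
        unfolding d.mball_def by blast
      then show ?thesis
        using near[of w] d.triangle[of z w q] d.commute[of q w] by simp
    qed
    from this[of e] this[of e'] show False
      using d.triangle[of e z e'] d.commute[of e z] d.nonneg[of e e'] by (simp add: \<delta>_def)
  qed
  with \<delta> show ?thesis
    by blast
qed

end
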